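(* Consider a Markov decision process with finite state space $\mathcal{X}$, finite action space $\mathcal{U}$, cost vector $\mathcal{R}\in\mathbb{R}^{|\mathcal{X}|}$ and discount factor $\alpha\in\,]0,1[$, and two different transition probability matrices $\mathcal{P}^*$ (the optimal one) and $\bar{\mathcal{P}}$, with associated cost functions $J^*$ and $\bar J$ respectively, i.e. $J^*=\mathcal{R}+\alpha\mathcal{P}^*J^*$ and $\bar J=\mathcal{R}+\alpha\bar{\mathcal{P}}\bar J$. Let $\bar{\mathcal{P}}=(I-\mathcal{A})\mathcal{Q}+\mathcal{A}\mathcal{P}^*$, where $\mathcal{A}=\alpha I$ and $\mathcal{Q}$ is a stochastic matrix. If $\|\mathcal{P}^*-\bar{\mathcal{P}}\|_\infty\le 1-\alpha$, then $$\|J^*-\bar J\|_\infty\le\frac{\alpha\|\mathcal{R}\|_\infty}{1-\alpha}.$$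
   Context: The Markov decision process has controlled transition probabilities $\mathcal{P}_{xx'}(u)$ for $x,x'\in\mathcal{X}$, $u\in\mathcal{U}$, and instantaneous costs $\mathcal{R}(x)$ not depending on the action. The optimal cost $J^*\in\mathbb{R}^{|\mathcal{X}|}$ is the unique solution of $J^*(x)=\min_{u\in\mathcal{U}}\big[\mathcal{R}(x)+\alpha\sum_{x'}\mathcal{P}_{xx'}(u)J^*(x')\big]$ for all $x \in \mathcal{X}$; if $\mu^*:\mathcal{X}\to\mathcal{U}$ is a stationary policy attaining these minima, then $\mathcal{P}^*_{xx'}=\mathcal{P}_{xx'}(\mu^*(x))$. The same discount factor $\alpha$ appears in the Bellman equations and in $\mathcal{A}$. A stochastic matrix is a square matrix with nonnegative entries and row sums equal to 1. For vectors, $\|v\|_\infty=\max_x|v(x)|$; for matrices, $\|M\|_\infty=\max_x\sum_{x'}|M_{xx'}|$ (maximum absolute row sum). *)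

theory Defs
  imports "HOL-Analysis.Analysis"
begin

definition stochastic_matrix :: "real^'x^'x \<Rightarrow> bool" where
  "stochastic_matrix M \<longleftrightarrow>
     (\<forall>x x'. 0 \<le> M $ x $ x') \<and> (\<forall>x. (\<Sum>x'\<in>UNIV. M $ x $ x') = 1)"

text \<open>
  The operator norm induced by the vector norm \<open>infnorm\<close>. Neither \<open>norm\<close> (Frobenius),
  \<open>onorm\<close> (spectral) nor \<open>infnorm\<close> (largest entry) of a matrix is this norm.
\<close>
definition max_row_sum :: "real^'n^'m \<Rightarrow> real" where
  "max_row_sum M = Max (range (\<lambda>x. \<Sum>x'\<in>UNIV. \<bar>M $ x $ x'\<bar>))"

text \<open>
  The entry \<open>P u $ x $ x'\<close> is the probability of moving from \<open>x\<close> to \<open>x'\<close> under action \<open>u\<close>.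
\<close>
definition controlled_transition_probabilities :: "('u \<Rightarrow> real^'x^'x) \<Rightarrow> bool" where
  "controlled_transition_probabilities P \<longleftrightarrow> (\<forall>u. stochastic_matrix (P u))"

definition action_value ::
  "('u \<Rightarrow> real^'x^'x) \<Rightarrow> real^'x \<Rightarrow> real \<Rightarrow> real^'x \<Rightarrow> 'x \<Rightarrow> 'u \<Rightarrow> real" where
  "action_value P R \<alpha> J x u = R $ x + \<alpha> * (\<Sum>x'\<in>UNIV. P u $ x $ x' * J $ x')"

definition optimal_cost ::
  "('u::finite \<Rightarrow> real^'x^'x) \<Rightarrow> real^'x \<Rightarrow> real \<Rightarrow> real^'x \<Rightarrow> bool" where
  "optimal_cost P R \<alpha> J \<longleftrightarrow> (\<forall>x. J $ x = Min (range (action_value P R \<alpha> J x)))"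

definition attains_minima ::
  "('u::finite \<Rightarrow> real^'x^'x) \<Rightarrow> real^'x \<Rightarrow> real \<Rightarrow> real^'x \<Rightarrow> ('x \<Rightarrow> 'u) \<Rightarrow> bool" where
  "attains_minima P R \<alpha> J \<mu> \<longleftrightarrow>
     (\<forall>x. action_value P R \<alpha> J x (\<mu> x) = Min (range (action_value P R \<alpha> J x)))"

definition policy_matrix :: "('u \<Rightarrow> real^'x^'x) \<Rightarrow> ('x \<Rightarrow> 'u) \<Rightarrow> real^'x^'x" where
  "policy_matrix P \<mu> = (\<chi> x x'. P (\<mu> x) $ x $ x')"

definition associated_cost :: "real^'x^'x \<Rightarrow> real^'x \<Rightarrow> real \<Rightarrow> real^'x \<Rightarrow> bool" where
  "associated_cost M R \<alpha> J \<longleftrightarrow> J = R + \<alpha> *\<^sub>R (M *v J)"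

end

theory Submission
  imports Defs
begin

text \<open>
  The difference \<open>d = Jstar - Jbar\<close> solves the fixed-point equation
  \<open>d = w + \<alpha> Pbar d\<close> with \<open>w = \<alpha> (Pstar - Pbar) Jstar\<close>. Since stochastic matrices do not
  expand \<open>infnorm\<close>, a solution of such an equation has norm at most \<open>infnorm w / (1 - \<alpha>)\<close>.
  Applied to \<open>Jstar\<close> this gives \<open>infnorm Jstar \<le> infnorm R / (1 - \<alpha>)\<close>, and applied to \<open>d\<close> the
  factor \<open>1 - \<alpha>\<close> from the perturbation bound cancels.
\<close>

lemma infnorm_cart_le_iff:
  fixes v :: "real^'n"
  shows "infnorm v \<le> c \<longleftrightarrow> (\<forall>i. \<bar>v $ i\<bar> \<le> c)"
proof
  assume "infnorm v \<le> c"
  then show "\<forall>i. \<bar>v $ i\<bar> \<le> c"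
    using component_le_infnorm_cart order_trans by blast
next
  assume "\<forall>i. \<bar>v $ i\<bar> \<le> c"
  then show "infnorm v \<le> c"
    unfolding infnorm_cart by (intro cSup_least) auto
qed

text \<open>In each row, the triangle inequality and the bound of every entry of \<open>v\<close> by
  \<open>infnorm v\<close> leave an absolute row sum as factor.\<close>

lemma infnorm_matrix_vector_mult_le:
  fixes M :: "real^'n^'m"
  shows "infnorm (M *v v) \<le> max_row_sum M * infnorm v"
  unfolding infnorm_cart_le_iff
proof
  fix i
  have "\<bar>(M *v v) $ i\<bar> \<le> (\<Sum>j\<in>UNIV. \<bar>M $ i $ j\<bar> * \<bar>v $ j\<bar>)"
    unfolding matrix_vector_mult_def by (simp add: abs_mult[symmetric])
  also have "\<dots> \<le> (\<Sum>j\<in>UNIV. \<bar>M $ i $ j\<bar>) * infnorm v"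
    unfolding sum_distrib_right
    by (intro sum_mono mult_left_mono component_le_infnorm_cart) auto
  also have "\<dots> \<le> max_row_sum M * infnorm v"
    unfolding max_row_sum_def by (intro mult_right_mono Max_ge infnorm_pos_le) auto
  finally show "\<bar>(M *v v) $ i\<bar> \<le> max_row_sum M * infnorm v" .
qed

lemma max_row_sum_stochastic_matrix:
  "stochastic_matrix M \<Longrightarrow> max_row_sum M = 1"
  by (simp add: stochastic_matrix_def max_row_sum_def)

lemma stochastic_matrix_convex_combination:
  assumes "stochastic_matrix M" "stochastic_matrix N" "0 \<le> t" "t \<le> 1"
  shows "stochastic_matrix ((1 - t) *\<^sub>R M + t *\<^sub>R N)"
  using assms by (simp add: stochastic_matrix_def sum.distrib flip: sum_distrib_left)

lemma stochastic_policy_matrix: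
  "controlled_transition_probabilities P \<Longrightarrow> stochastic_matrix (policy_matrix P \<mu>)"
  by (simp add: controlled_transition_probabilities_def policy_matrix_def stochastic_matrix_def)

text \<open>The triangle inequality and \<open>max_row_sum M = 1\<close> give
  \<open>infnorm J\<close> \<le> \<open>infnorm R\<close> + \<alpha> * \<open>infnorm J\<close>,
  which is solved for \<open>infnorm J\<close>. The vector \<open>R\<close> is arbitrary, so a
  perturbation term can take the place of the cost.\<close>

lemma infnorm_associated_cost_le:
  assumes "associated_cost M R \<alpha> J" "stochastic_matrix M" "0 \<le> \<alpha>" "\<alpha> < 1"
  shows "infnorm J \<le> infnorm R / (1 - \<alpha>)"
proof -
  have "infnorm J \<le> infnorm R + infnorm (\<alpha> *\<^sub>R (M *v J))"
    using assms(1) infnorm_triangle unfolding associated_cost_def by metis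
  also have "\<dots> \<le> infnorm R + \<alpha> * infnorm J"
    using infnorm_matrix_vector_mult_le[of M J] assms(2,3)
    by (simp add: infnorm_mul max_row_sum_stochastic_matrix mult_left_mono)
  finally show ?thesis
    using assms(4) by (simp add: field_simps)
qed

text \<open>Subtraction cancels \<open>R\<close>; inserting \<open>N *v J\<close> splits
  \<open>M *v J - N *v K\<close> into \<open>(M - N) *v J\<close> and
  \<open>N *v (J - K)\<close>.\<close>

lemma associated_cost_diff:
  assumes "associated_cost M R \<alpha> J" "associated_cost N R \<alpha> K"
  shows "associated_cost N (\<alpha> *\<^sub>R ((M - N) *v J)) \<alpha> (J - K)"
proof -
  have "J - K = \<alpha> *\<^sub>R (M *v J) - \<alpha> *\<^sub>R (N *v K)"
    using assms unfolding associated_cost_def by (metis add_diff_cancel_left)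
  then show ?thesis
    unfolding associated_cost_def
    by (simp add: matrix_vector_mult_diff_rdistrib matrix_vector_mult_diff_distrib algebra_simps)
qed

theorem theorem4:
  fixes P :: "'u::finite \<Rightarrow> real^'x^'x"
    and R Jstar Jbar :: "real^'x"
    and \<alpha> :: real
    and \<mu>star :: "'x \<Rightarrow> 'u"
    and Pstar Pbar A Q :: "real^'x^'x"
  assumes "controlled_transition_probabilities P"
    and "0 < \<alpha>" and "\<alpha> < 1"
    and "optimal_cost P R \<alpha> Jstar"
    and "attains_minima P R \<alpha> Jstar \<mu>star"
    and "Pstar = policy_matrix P \<mu>star"
    and "Pstar \<noteq> Pbar"
    and "associated_cost Pstar R \<alpha> Jstar"
    and "associated_cost Pbar R \<alpha> Jbar"
    and "A = \<alpha> *\<^sub>R mat 1"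
    and "stochastic_matrix Q"
    and "Pbar = (mat 1 - A) ** Q + A ** Pstar"
    and "max_row_sum (Pstar - Pbar) \<le> 1 - \<alpha>"
  shows "infnorm (Jstar - Jbar) \<le> \<alpha> * infnorm R / (1 - \<alpha>)"
proof -
  have "stochastic_matrix Pstar"
    using assms(1,6) stochastic_policy_matrix by blast
  \<comment> \<open>As \<open>A\<close> is a scalar matrix, \<open>Pbar\<close> is a convex
    combination of \<open>Q\<close> and \<open>Pstar\<close>, hence stochastic.\<close>
  have "mat 1 - A = (1 - \<alpha>) *\<^sub>R mat 1"
    using assms(10) by (simp add: scaleR_diff_left)
  then have "Pbar = (1 - \<alpha>) *\<^sub>R Q + \<alpha> *\<^sub>R Pstar"
    using assms(10,12)
    by (simp flip: scalar_matrix_assoc)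
  then have "stochastic_matrix Pbar"
    using assms(2,3,11) \<open>stochastic_matrix Pstar\<close>
    by (simp add: stochastic_matrix_convex_combination)
  have "infnorm ((Pstar - Pbar) *v Jstar) \<le> max_row_sum (Pstar - Pbar) * infnorm Jstar"
    by (rule infnorm_matrix_vector_mult_le)
  also have "\<dots> \<le> (1 - \<alpha>) * (infnorm R / (1 - \<alpha>))"
    using assms(2,3,13) infnorm_associated_cost_le[OF assms(8) \<open>stochastic_matrix Pstar\<close>]
    by (intro mult_mono infnorm_pos_le) auto
  also have "\<dots> = infnorm R"
    using assms(3) by simp
  finally have perturbation: "infnorm ((Pstar - Pbar) *v Jstar) \<le> infnorm R" .
  \<comment> \<open>Here \<open>Pbar\<close> is the transition matrix and the perturbation term is
    the cost vector.\<close>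
  have "infnorm (Jstar - Jbar) \<le> infnorm (\<alpha> *\<^sub>R ((Pstar - Pbar) *v Jstar)) / (1 - \<alpha>)"
    using infnorm_associated_cost_le[OF associated_cost_diff[OF assms(8,9)] \<open>stochastic_matrix Pbar\<close>] assms(2,3)
    by simp
  also have "\<dots> \<le> \<alpha> * infnorm R / (1 - \<alpha>)"
    using perturbation assms(2,3) by (simp add: infnorm_mul divide_right_mono)
  finally show ?thesis .
qed

end
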